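(* Let $a=(a_j)_{j\ge 1}$ be a sequence of positive numbers with $\sum_{j\ge1} a_j=1$, let $s_k=\sum_{j>k}a_j$, and let $e_n^*(a)$ be as defined in the context. (i) Suppose that the sequence $a$ is monotonic, i.e. $a_1\ge a_2\ge\dots$. Then $$e_n^*(a)^2\ge (n+1)\sum_{j\ge 1}a_{j(n+1)} .$$ In particular, $e_n^*(a)^2\ge (n+1)a_{n+1}$. (ii) Given $\gamma\in(0,1)$, suppose that $$k\,|\log s_k|^{1+\frac1\gamma}\lesssim n.$$ Then $e_n^*(a)^2\le C(\gamma)\,s_k$. (iii) Given $\sigma\in(0,\tfrac12]$, suppose that $$k^2\,|\log s_k|^{-1}\le \tfrac18\,\sigma n .$$ Then $e_n^*(a)^2\le s_k^{1-\sigma}$.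
   Context: $\mathbb{T}$ is the unit circle; $n$ and $k$ are positive integers. For a finite positive Borel measure $\rho$ on $\mathbb{T}$, $e_n(\rho)\ge 0$ is defined by $$e_n(\rho)^2=\min_{q_0,\dots,q_{n-1}}\int_{\mathbb{T}}\bigl|t^n+q_{n-1}t^{n-1}+\dots+q_1t+q_0\bigr|^2\,d\rho(t).$$ For a sequence $a=(a_j)_{j\ge1}$ of positive numbers with $\sum_j a_j=1$, $$e_n^*(a)=\sup_{(\lambda_j)\subset\mathbb{T}} e_n\Bigl(\sum_{j\ge 1}a_j\delta_{\lambda_j}\Bigr),$$ where the supremum is over all sequences $(\lambda_j)_{j\ge1}$ of points of $\mathbb{T}$ and $\delta_\lambda$ is the unit point mass at $\lambda$. For positive $A$ and $B$, $A\lesssim B$ means that $A\le CB$ with a positive numerical constant $C$. $C(\gamma)$ denotes a positive constant depending only on $\gamma$.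
   Formalization: Part (iii) is proved under the additional assumption k ≤ n; without it the claim is false (e.g. n=1, k=2, σ=1/2, a_1=a_2=(1-s_2)/2, s_2=e^{-64}, with λ_1=1, λ_2=-1). *)

theory Defs
  imports "HOL-Analysis.Analysis"
begin

abbreviation circle_borel :: "complex measure" where
  "circle_borel \<equiv> restrict_space borel (sphere 0 1)"

text \<open>
  The quantity $e_n(\rho)$, for a finite measure \<open>\<rho>\<close> on \<open>circle_borel\<close>; only
  \<open>q 0, \<dots>, q (n - 1)\<close> matter.  The infimum is a minimum, being the squared distance in
  $L^2(\rho)$ of $t^n$ to a finite-dimensional subspace.
\<close>

definition szego_e :: "nat \<Rightarrow> complex measure \<Rightarrow> real" where
  "szego_e n \<rho> =
     sqrt (INF q :: nat \<Rightarrow> complex. LINT t|\<rho>. (cmod (t ^ n + (\<Sum>i<n. q i * t ^ i)))\<^sup>2)"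

text \<open>
  Sequences are indexed from 1, so the values at 0 are ignored.  The measure
  $\sum_{j \ge 1} a_j \delta_{\lambda_j}$ is the image under \<open>\<lambda>\<close> of the measure on
  \<open>{1..}\<close> with weights \<open>a j\<close>; see \<open>emeasure_atomic_measure\<close> below.
\<close>

definition atomic_measure :: "(nat \<Rightarrow> real) \<Rightarrow> (nat \<Rightarrow> complex) \<Rightarrow> complex measure" where
  "atomic_measure a l =
     distr (density (count_space {1..}) (\<lambda>j. ennreal (a j))) circle_borel l"

definition szego_e_star :: "nat \<Rightarrow> (nat \<Rightarrow> real) \<Rightarrow> real" where
  "szego_e_star n a = (SUP l \<in> {1..} \<rightarrow> sphere 0 1. szego_e n (atomic_measure a l))"

definition weight_seq :: "(nat \<Rightarrow> real) \<Rightarrow> bool" where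
  "weight_seq a \<longleftrightarrow> (\<forall>j\<ge>1. a j > 0) \<and> (a has_sum 1) {1..}"

definition tail_sum :: "(nat \<Rightarrow> real) \<Rightarrow> nat \<Rightarrow> real" where
  "tail_sum a k = (\<Sum>\<^sub>\<infinity>j\<in>{k<..}. a j)"

lemma sets_atomic_measure: "sets (atomic_measure a l) = sets circle_borel"
  by (simp add: atomic_measure_def)

lemma emeasure_atomic_measure:
  assumes l: "l \<in> {1..} \<rightarrow> sphere 0 1" and A: "A \<in> sets circle_borel"
  shows "emeasure (atomic_measure a l) A = (\<Sum>j. ennreal (a (Suc j)) * indicator A (l (Suc j)))"
proof -
  let ?D = "density (count_space {1::nat..}) (\<lambda>j. ennreal (a j))"
  have m: "l \<in> measurable ?D circle_borel"
    using l by (auto simp: measurable_restrict_space2_iff)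
  have "emeasure (atomic_measure a l) A = emeasure ?D (l -` A \<inter> {1..})"
    unfolding atomic_measure_def using emeasure_distr[OF m A] by simp
  also have "\<dots> = (\<integral>\<^sup>+ j. ennreal (a j) * indicator A (l j) \<partial>count_space {1..})"
    by (subst emeasure_density)
      (auto intro!: nn_integral_cong split: split_indicator)
  also have "\<dots> = (\<integral>\<^sup>+ j. ennreal (a (Suc j)) * indicator A (l (Suc j)) \<partial>count_space UNIV)"
  proof -
    have "bij_betw Suc UNIV {1..}"
      by (rule bij_betwI[of _ _ _ "\<lambda>n. n - 1"]) auto
    then show ?thesis
      by (rule nn_integral_bij_count_space[symmetric])
  qed
  also have "\<dots> = (\<Sum>j. ennreal (a (Suc j)) * indicator A (l (Suc j)))"
    by (rule nn_integral_count_space_nat)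
  finally show ?thesis .
qed

lemma szego_e_atomic_measure_le_1:
  assumes a: "weight_seq a" and l: "l \<in> {1..} \<rightarrow> sphere 0 1"
  shows "szego_e n (atomic_measure a l) \<le> 1"
proof -
  let ?M = "atomic_measure a l"
  have sp: "space ?M = sphere 0 1"
    by (simp add: atomic_measure_def space_restrict_space)
  have "(a has_sum 1) {1..}" and pos: "\<And>j. j \<ge> 1 \<Longrightarrow> a j > 0"
    using a by (auto simp: weight_seq_def)
  moreover have "bij_betw Suc UNIV {1..}"
    by (rule bij_betwI[of _ _ _ "\<lambda>n. n - 1"]) auto
  ultimately have "((\<lambda>j. a (Suc j)) has_sum 1) UNIV"
    using has_sum_reindex_bij_betw[of Suc UNIV "{1..}" a 1] by simp
  then have su: "(\<lambda>j. a (Suc j)) sums 1"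
    by (rule has_sum_imp_sums)
  have "emeasure ?M (sphere 0 1) = (\<Sum>j. ennreal (a (Suc j)) * indicator (sphere 0 1) (l (Suc j)))"
    by (rule emeasure_atomic_measure[OF l]) (auto simp: sets_restrict_space)
  also have "\<dots> = (\<Sum>j. ennreal (a (Suc j)))"
  proof (rule suminf_cong)
    show "ennreal (a (Suc j)) * indicator (sphere 0 1) (l (Suc j)) = ennreal (a (Suc j))" for j
      using funcset_mem[OF l, of "Suc j"] by simp
  qed
  also have "\<dots> = 1"
    using su pos by (subst suminf_ennreal_eq[where x = 1]) (auto intro: less_imp_le)
  finally have m: "measure ?M (space ?M) = 1"
    by (simp add: measure_def sp)
  let ?F = "\<lambda>q. LINT t|?M. (cmod (t ^ n + (\<Sum>i<n. q i * t ^ i)))\<^sup>2"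
  have "(INF q. ?F q) \<le> ?F (\<lambda>_. 0)"
    by (rule cINF_lower) (auto intro!: bdd_belowI2[where m = 0] integral_nonneg_AE)
  also have "\<dots> = (LINT t|?M. 1)"
    by (rule Bochner_Integration.integral_cong) (auto simp: sp norm_power)
  also have "\<dots> = 1"
    using m by simp
  finally show ?thesis
    by (simp add: szego_e_def)
qed

text \<open>Hence the supremum defining \<^const>\<open>szego_e_star\<close> is that of a bounded set.\<close>

lemma bdd_above_szego_e:
  assumes "weight_seq a"
  shows "bdd_above ((\<lambda>l. szego_e n (atomic_measure a l)) ` ({1..} \<rightarrow> sphere 0 1))"
  using szego_e_atomic_measure_le_1[OF assms] by (auto intro!: bdd_aboveI2[where M = 1])

end

theory Submission
  imports Defs "HOL-Complex_Analysis.Conformal_Mappings"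
begin

text \<open>
  (i) Put the points at the powers of a primitive $(n+1)$-st root of unity. By monotonicity every root
  of unity carries mass at least $\sum_j a_{j(n+1)}$, and by Parseval the sum of $|P|^2$ over the roots
  is at least $n+1$ for monic $P$ of degree $n$.

  For the upper bounds, pass to the reciprocal polynomial: any $Q$ with $Q(0)=1$ and degree at most $n$
  gives $e_n(\rho)^2 \le \int |Q|^2 d\rho$, and one wants $Q$ small at the first $k$ points and bounded
  on the circle.

  (ii) With $L = |\log s_k|$, the function
  $F(z) = \exp(1 - \frac1k \sum_i \frac{1 + z\bar\lambda_i}{1 - z\bar\lambda_i})$ is bounded by $e$ in the
  disc. For $\rho = 1 - 1/(kL)$ a de la Vallee Poussin mean of $F(\rho\,\cdot)$, evaluated at $\rho z$, is
  bounded on the circle and $O(e^{-L/2})$ at the $\lambda_i$ as soon as $n \ge kL^2$, since by the maximum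
  principle the error is $O(\rho^{n/2})$ with no dependence on $k$. The hypothesis gives $n \ge kL^2$ when
  $L$ is large; for bounded $L$ the trivial estimate $e_n \le 1$ suffices.

  (iii) A Fejer mean of $1 - sz/(1-rz)$ with $r = (m-1)/(m+1)$ yields a polynomial of degree $m$ with
  value 1 at 0, a zero at 1 and modulus at most $1 + 2/m$ on the circle. The product of $k$ rotated
  copies with $m = \lfloor n/k \rfloor$ vanishes at the first $k$ points and is bounded by $e^{4k^2/n}$.
\<close>

section \<open>Fejer means\<close>

lemma sum_roots_of_unity_orthogonal:
  fixes W p q :: nat
  assumes "p < W" "q < W"
  shows "(\<Sum>l<W. cis (2 * pi * real l / real W) ^ p * cnj (cis (2 * pi * real l / real W)) ^ q)
           = (if p = q then of_nat W else 0)"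
proof -
  define x where "x = cis (2 * pi * (real p - real q) / real W)"
  have W: "W > 0" using assms by simp
  have power: "cis (2 * pi * real l / real W) ^ p * cnj (cis (2 * pi * real l / real W)) ^ q = x ^ l" for l
    by (simp add: x_def cis_cnj Complex.DeMoivre cis_mult right_diff_distrib diff_divide_distrib mult_ac)
  show ?thesis
  proof (cases "p = q")
    case True
    then show ?thesis
      unfolding power by (simp add: x_def)
  next
    case False
    have "x ^ W = cis (2 * pi * of_int (int p - int q))"
      using W by (simp add: x_def Complex.DeMoivre)
    also have "\<dots> = 1"
      by (rule cis_multiple_2pi) simp
    finally have xW: "x ^ W = 1" .
    \<comment> \<open>If \<open>x = 1\<close> then \<open>W\<close> divides \<open>p - q\<close>,
      although 0 < |p - q| < W.\<close>
    have "x \<noteq> 1"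
    proof
      assume "x = 1"
      then have "cos (2 * pi * (real p - real q) / real W) = 1"
        by (simp add: x_def complex_eq_iff)
      then obtain m :: int where "2 * pi * (real p - real q) / real W = real_of_int m * 2 * pi"
        by (auto simp: cos_one_2pi_int)
      then have "2 * pi * (real p - real q) = 2 * pi * (real_of_int m * real W)"
        using W by (simp add: divide_eq_eq mult_ac)
      then have "real p - real q = real_of_int m * real W"
        by simp
      then have m: "int p - int q = m * int W"
        by (metis of_int_diff of_int_eq_iff of_int_mult of_int_of_nat_eq)
      have "int p - int q \<noteq> 0" "int W dvd int p - int q"
        using False by (simp, simp only: m dvd_triv_right)
      then have "\<bar>int W\<bar> \<le> \<bar>int p - int q\<bar>"
        by (rule dvd_imp_le_int)
      then show False
        using assms by simp
    qed
    then have "(\<Sum>l<W. x ^ l) = 0"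
      using xW by (simp add: geometric_sum)
    with False show ?thesis by (simp add: power)
  qed
qed

text \<open>Finite averages over roots of unity stand in for integrals over the circle. The identity
  is used twice: it gives the total mass of the Fejer kernel, and it gives the lower bound in
  (i).\<close>

lemma parseval_roots_of_unity:
  fixes b :: "nat \<Rightarrow> complex"
  shows "(\<Sum>l<W. (cmod (\<Sum>j<W. b j * cis (2 * pi * real l / real W) ^ j))\<^sup>2)
           = real W * (\<Sum>j<W. (cmod (b j))\<^sup>2)"
proof -
  let ?w = "\<lambda>l. cis (2 * pi * real l / real W)"
  have "complex_of_real (\<Sum>l<W. (cmod (\<Sum>j<W. b j * ?w l ^ j))\<^sup>2)
      = (\<Sum>l<W. (\<Sum>p<W. b p * ?w l ^ p) * cnj (\<Sum>q<W. b q * ?w l ^ q))"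
    by (simp only: of_real_sum complex_norm_square)
  also have "\<dots> = (\<Sum>l<W. \<Sum>p<W. \<Sum>q<W. b p * cnj (b q) * (?w l ^ p * cnj (?w l) ^ q))"
    by (simp add: sum_product mult_ac)
  also have "\<dots> = (\<Sum>p<W. \<Sum>l<W. \<Sum>q<W. b p * cnj (b q) * (?w l ^ p * cnj (?w l) ^ q))"
    by (rule sum.swap)
  also have "\<dots> = (\<Sum>p<W. \<Sum>q<W. \<Sum>l<W. b p * cnj (b q) * (?w l ^ p * cnj (?w l) ^ q))"
    by (intro sum.cong refl sum.swap)
  also have "\<dots> = (\<Sum>p<W. \<Sum>q<W. b p * cnj (b q) * (if p = q then of_nat W else 0))"
    unfolding sum_distrib_left[symmetric]
    by (intro sum.cong refl) (simp add: sum_roots_of_unity_orthogonal)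
  also have "\<dots> = of_nat W * (\<Sum>p<W. b p * cnj (b p))"
    by (simp add: sum_distrib_left if_distrib mult_ac cong: if_cong)
  also have "\<dots> = complex_of_real (real W * (\<Sum>j<W. (cmod (b j))\<^sup>2))"
    by (simp add: complex_norm_square[symmetric])
  finally show ?thesis
    by (simp only: of_real_eq_iff)
qed

text \<open>The Cesaro mean of the partial sums of orders 0 to \<open>N\<close> of the power series
  with coefficients \<open>c\<close>. As a formal polynomial it has a degree and can be composed
  with dilations.\<close>

definition fejer_mean :: "nat \<Rightarrow> (nat \<Rightarrow> complex) \<Rightarrow> complex poly" where
  "fejer_mean N c = (\<Sum>j\<le>N. monom (of_real (1 - real j / real (N + 1)) * c j) j)"

lemma poly_fejer_mean:
  "poly (fejer_mean N c) z = (\<Sum>j\<le>N. of_real (1 - real j / real (N + 1)) * c j * z ^ j)"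
  by (simp add: fejer_mean_def poly_sum poly_monom)

lemma coeff_fejer_mean:
  "coeff (fejer_mean N c) i = (if i \<le> N then of_real (1 - real i / real (N + 1)) * c i else 0)"
  by (auto simp: fejer_mean_def coeff_sum)

lemma degree_fejer_mean: "degree (fejer_mean N c) \<le> N"
  by (rule degree_le) (simp add: coeff_fejer_mean)

text \<open>Up to the factor \<open>W * (N + 1)\<close>, the mean is the sum of the values at the
  rotated points \<open>z * ?w l\<close>, weighted by the squared moduli of the Dirichlet sums
  \<open>?D l\<close>. These weights are nonnegative with total \<open>W * (N + 1)\<close>, so a
  bound on the circle is inherited.\<close>

lemma norm_fejer_mean_polynomial_le:
  fixes c :: "nat \<Rightarrow> complex"
  assumes bound: "\<And>z. norm z = 1 \<Longrightarrow> norm (\<Sum>j<T. c j * z ^ j) \<le> M"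
    and "N < T" and z: "norm z = 1"
  shows "norm (poly (fejer_mean N c) z) \<le> M"
proof -
  \<comment> \<open>All exponents \<open>j + a\<close> and \<open>b\<close> below are less than
    \<open>W\<close>, so orthogonality applies without aliasing.\<close>
  define W where "W = T + N + 1"
  let ?w = "\<lambda>l. cis (2 * pi * real l / real W)"
  let ?D = "\<lambda>l. \<Sum>a\<le>N. ?w l ^ a"
  let ?p = "\<lambda>z. \<Sum>j<T. c j * z ^ j"
  have "(\<Sum>l<W. ?p (z * ?w l) * (?D l * cnj (?D l)))
      = (\<Sum>l<W. \<Sum>j<T. \<Sum>a\<le>N. \<Sum>b\<le>N. c j * z ^ j * (?w l ^ (j + a) * cnj (?w l) ^ b))"
  proof (intro sum.cong refl)
    fix l
    have "?p (z * ?w l) * (?D l * cnj (?D l))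
        = (\<Sum>j<T. c j * (z * ?w l) ^ j * (\<Sum>a\<le>N. ?w l ^ a * (\<Sum>b\<le>N. cnj (?w l) ^ b)))"
      by (simp add: sum_distrib_right)
    also have "\<dots> = (\<Sum>j<T. \<Sum>a\<le>N. \<Sum>b\<le>N. c j * z ^ j * (?w l ^ (j + a) * cnj (?w l) ^ b))"
      unfolding sum_distrib_left by (simp add: power_mult_distrib power_add mult_ac)
    finally show "?p (z * ?w l) * (?D l * cnj (?D l))
        = (\<Sum>j<T. \<Sum>a\<le>N. \<Sum>b\<le>N. c j * z ^ j * (?w l ^ (j + a) * cnj (?w l) ^ b))" .
  qed
  also have "\<dots> = (\<Sum>j<T. \<Sum>a\<le>N. \<Sum>b\<le>N. \<Sum>l<W. c j * z ^ j * (?w l ^ (j + a) * cnj (?w l) ^ b))"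
  proof -
    have "(\<Sum>l\<in>A. \<Sum>j<T. \<Sum>a\<le>N. \<Sum>b\<le>N. G l j a b) = (\<Sum>j<T. \<Sum>a\<le>N. \<Sum>b\<le>N. \<Sum>l\<in>A. G l j a b)"
      for A :: "nat set" and G :: "nat \<Rightarrow> nat \<Rightarrow> nat \<Rightarrow> nat \<Rightarrow> complex"
      by (simp only: sum.swap[where A = A])
    then show ?thesis .
  qed
  also have "\<dots> = (\<Sum>j<T. \<Sum>a\<le>N. \<Sum>b\<le>N. c j * z ^ j * (if j + a = b then of_nat W else 0))"
    unfolding sum_distrib_left[symmetric]
    by (intro sum.cong refl arg_cong2[where f = "(*)"] sum_roots_of_unity_orthogonal) (auto simp: W_def)
  also have "\<dots> = (\<Sum>j<T. \<Sum>a\<le>N. if j + a \<le> N then of_nat W * (c j * z ^ j) else 0)"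
    by (intro sum.cong refl) (simp add: if_distrib mult_ac cong: if_cong)
  \<comment> \<open>\<open>N + 1 - j\<close> counts the solutions of \<open>j + a = b\<close>;
    truncated subtraction makes it 0 for \<open>j > N\<close>.\<close>
  also have "\<dots> = (\<Sum>j<T. of_nat (N + 1 - j) * (of_nat W * (c j * z ^ j)))"
  proof (intro sum.cong refl)
    fix j
    have "{a. a \<le> N \<and> j + a \<le> N} = (if j \<le> N then {..N - j} else {})"
      by auto
    then have "card {a. a \<le> N \<and> j + a \<le> N} = N + 1 - j"
      by (auto simp: Suc_diff_le)
    then show "(\<Sum>a\<le>N. if j + a \<le> N then of_nat W * (c j * z ^ j) else 0)
        = of_nat (N + 1 - j) * (of_nat W * (c j * z ^ j))"
      by (subst sum.inter_filter[symmetric]) (auto)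
  qed
  also have "\<dots> = (\<Sum>j\<le>N. of_nat (N + 1 - j) * (of_nat W * (c j * z ^ j)))"
    using \<open>N < T\<close> by (intro sum.mono_neutral_right) auto
  also have "\<dots> = of_nat W * of_nat (N + 1) * poly (fejer_mean N c) z"
    unfolding poly_fejer_mean sum_distrib_left
  proof (intro sum.cong refl)
    fix j assume "j \<in> {..N}"
    then have "real (N + 1 - j) = real (N + 1) * (1 - real j / real (N + 1))"
      by (simp add: of_nat_diff field_simps)
    then have "of_nat (N + 1 - j) = of_nat (N + 1) * complex_of_real (1 - real j / real (N + 1))"
      by (metis of_real_mult of_real_of_nat_eq)
    then show "of_nat (N + 1 - j) * (of_nat W * (c j * z ^ j))
        = of_nat W * of_nat (N + 1) * (of_real (1 - real j / real (N + 1)) * c j * z ^ j)"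
      by simp
  qed
  finally have eq: "of_nat W * of_nat (N + 1) * poly (fejer_mean N c) z
      = (\<Sum>l<W. ?p (z * ?w l) * of_real ((cmod (?D l))\<^sup>2))"
    by (simp only: complex_norm_square)
  have "real W * real (N + 1) * norm (poly (fejer_mean N c) z)
      = norm (\<Sum>l<W. ?p (z * ?w l) * of_real ((cmod (?D l))\<^sup>2))"
    unfolding eq[symmetric] norm_mult norm_of_nat ..
  also have "\<dots> \<le> (\<Sum>l<W. M * (cmod (?D l))\<^sup>2)"
    by (intro sum_norm_le) (auto simp: norm_mult z simp del: of_real_power intro!: mult_right_mono bound)
  also have "\<dots> = M * (real W * real (N + 1))"
  proof -
    have "(\<Sum>j<W. (if j \<le> N then 1 else 0) * ?w l ^ j) = ?D l" for l
      by (rule sum.mono_neutral_cong_right) (auto simp: W_def)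
    moreover have "(\<Sum>j<W. (cmod (if j \<le> N then 1 else 0))\<^sup>2) = (\<Sum>j\<le>N. 1)"
      by (rule sum.mono_neutral_cong_right) (auto simp: W_def)
    ultimately show ?thesis
      using parseval_roots_of_unity[of "\<lambda>j. if j \<le> N then 1 else 0" W]
      by (simp add: sum_distrib_left[symmetric] add.commute)
  qed
  finally show ?thesis
    by (simp add: W_def mult.commute del: of_nat_add of_nat_Suc)
qed

text \<open>The mean depends only on \<open>c 0\<close>, ..., \<open>c N\<close>, so the series may
  be cut at any \<open>T > N\<close>. Absolute convergence makes the cut cost at most
  \<open>e\<close>, uniformly on the circle.\<close>

lemma norm_fejer_mean_le:
  fixes c :: "nat \<Rightarrow> complex"
  assumes c: "summable (\<lambda>j. norm (c j))"
    and bound: "\<And>z. norm z = 1 \<Longrightarrow> norm (\<Sum>j. c j * z ^ j) \<le> M"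
    and z: "norm z = 1"
  shows "norm (poly (fejer_mean N c) z) \<le> M"
proof (rule field_le_epsilon)
  fix e :: real
  assume "e > 0"
  then obtain T0 where T0: "\<And>T. T \<ge> T0 \<Longrightarrow> norm (\<Sum>i. norm (c (i + T))) < e"
    using suminf_exist_split[OF _ c] by blast
  define T where "T = max T0 (N + 1)"
  show "norm (poly (fejer_mean N c) z) \<le> M + e"
  proof (rule norm_fejer_mean_polynomial_le[OF _ _ z])
    fix z :: complex
    assume z: "norm z = 1"
    have s: "summable (\<lambda>j. norm (c j * z ^ j))"
      using c by (simp add: norm_mult norm_power z)
    have "(\<Sum>j<T. c j * z ^ j) = (\<Sum>j. c j * z ^ j) - (\<Sum>i. c (i + T) * z ^ (i + T))"
      using suminf_split_initial_segment[OF summable_norm_cancel[OF s], of T] by simp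
    also have "norm \<dots> \<le> norm (\<Sum>j. c j * z ^ j) + norm (\<Sum>i. c (i + T) * z ^ (i + T))"
      by (rule norm_triangle_ineq4)
    also have "norm (\<Sum>i. c (i + T) * z ^ (i + T)) \<le> (\<Sum>i. norm (c (i + T) * z ^ (i + T)))"
      by (rule summable_norm) (rule summable_ignore_initial_segment[OF s])
    also have "\<dots> = (\<Sum>i. norm (c (i + T)))"
      by (simp add: norm_mult norm_power z)
    also have "\<dots> \<le> e"
      using T0[of T] by (simp add: T_def)
    finally show "norm (\<Sum>j<T. c j * z ^ j) \<le> M + e"
      using bound[OF z] by simp
  qed (simp add: T_def)
qed

section \<open>Polynomial approximation with geometric error inside the disc\<close>

text \<open>A Schwarz lemma of order \<open>M\<close>: the quotient of \<open>h\<close> by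
  \<open>z ^ M\<close>, written as the shifted series \<open>g\<close>, obeys the maximum principle.
  Since \<open>R > 1\<close>, it is continuous up to the circle, where its modulus is that of
  \<open>h\<close>.\<close>

lemma norm_power_series_le_of_order:
  fixes b :: "nat \<Rightarrow> complex"
  assumes R: "R > 1" and sums: "\<And>z. norm z < R \<Longrightarrow> (\<lambda>j. b j * z ^ j) sums h z"
    and zero: "\<And>j. j < M \<Longrightarrow> b j = 0"
    and bound: "\<And>z. norm z = 1 \<Longrightarrow> norm (h z) \<le> B"
    and z: "norm z \<le> 1"
  shows "norm (h z) \<le> B * norm z ^ M"
proof -
  define g where "g z = (\<Sum>j. b (j + M) * z ^ j)" for z
  have shifted: "(\<lambda>j. b (j + M) * z ^ j * z ^ M) sums h z" if "norm z < R" for z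
  proof -
    have "(\<lambda>j. b (j + M) * z ^ (j + M)) sums (h z - (\<Sum>j<M. b j * z ^ j))"
      by (rule sums_split_initial_segment[OF sums[OF that]])
    then show ?thesis
      using zero by (simp add: power_add mult_ac)
  qed
  have g_sums: "(\<lambda>j. b (j + M) * z ^ j) sums g z" if "norm z < R" for z
  proof (cases "z = 0")
    case True
    then show ?thesis
      using powser_sums_zero[of "\<lambda>j. b (j + M)"] by (simp add: g_def sums_iff)
  next
    case False
    then have "summable (\<lambda>j. b (j + M) * z ^ j * z ^ M * inverse (z ^ M))"
      by (intro summable_mult2 sums_summable[OF shifted[OF that]])
    with False have "summable (\<lambda>j. b (j + M) * z ^ j)"
      by (simp add: mult.assoc)
    then show ?thesis
      by (simp add: g_def summable_sums)
  qed
  have h_eq: "h z = g z * z ^ M" if "norm z < R" for z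
    using sums_mult2[OF g_sums[OF that]] shifted[OF that] by (rule sums_unique2[symmetric])
  have hol: "g holomorphic_on ball 0 R"
    by (rule power_series_holomorphic[where a = "\<lambda>j. b (j + M)"]) (simp add: g_sums)
  have "norm (g z) \<le> B"
  proof (rule maximum_modulus_frontier[of g "cball 0 1"])
    show "g holomorphic_on interior (cball 0 1)"
      using R by (auto intro!: holomorphic_on_subset[OF hol])
    show "continuous_on (closure (cball 0 1)) g"
      using R by (auto intro!: holomorphic_on_imp_continuous_on holomorphic_on_subset[OF hol])
    show "norm (g w) \<le> B" if "w \<in> frontier (cball 0 1)" for w
    proof -
      have "norm w = 1"
        using that by simp
      then show ?thesis
        using bound[of w] h_eq[of w] R by (simp add: norm_mult norm_power)
    qed
  qed (use z in auto)
  then show ?thesis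
    using h_eq[of z] z R by (simp add: norm_mult norm_power mult_right_mono)
qed

text \<open>\<open>V\<close> is bounded by \<open>3 * B\<close> on the circle and shares the
  coefficients up to \<open>N\<close>, so \<open>f - V\<close> is bounded by \<open>4 * B\<close>
  there and vanishes to order \<open>N + 1\<close> at 0. The Schwarz-type bound then applies, with
  no loss from the size of later coefficients.\<close>

lemma bounded_power_series_approximation:
  fixes c :: "nat \<Rightarrow> complex"
  assumes R: "R > 1" and sums: "\<And>z. norm z < R \<Longrightarrow> (\<lambda>j. c j * z ^ j) sums f z"
    and bound: "\<And>z. norm z = 1 \<Longrightarrow> norm (f z) \<le> B"
  obtains V :: "complex poly" where "degree V \<le> 2 * N + 1" "coeff V 0 = c 0"
    "\<And>z. norm z \<le> 1 \<Longrightarrow> norm (f z - poly V z) \<le> 4 * B * norm z ^ (N + 1)"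
proof
  \<comment> \<open>the de la Vallee Poussin mean, which reproduces \<open>c 0, \<dots>, c N\<close>\<close>
  define V where "V = smult 2 (fejer_mean (2 * N + 1) c) - fejer_mean N c"
  have deg: "degree (fejer_mean (2 * N + 1) c) \<le> 2 * N + 1" "degree (fejer_mean N c) \<le> 2 * N + 1"
    using degree_fejer_mean[of N c] by (auto intro: degree_fejer_mean)
  show degV: "degree V \<le> 2 * N + 1"
    unfolding V_def using deg by (intro degree_diff_le) (auto simp: degree_smult_eq)
  have coeffV: "coeff V j = c j" if "j \<le> N" for j
  proof -
    \<comment> \<open>The order \<open>2 * N + 1\<close> is chosen so that the two linear weights
      cancel: \<open>2 * N + 2\<close> is twice \<open>N + 1\<close>.\<close>
    have "2 * (1 - real j / real (2 * N + 1 + 1)) - (1 - real j / real (N + 1)) = 1"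
      by (simp add: divide_simps) (simp add: algebra_simps)
    then have "2 * complex_of_real (1 - real j / real (2 * N + 1 + 1)) - of_real (1 - real j / real (N + 1)) = 1"
      by (metis of_real_1 of_real_diff of_real_mult of_real_numeral)
    moreover have "coeff V j = (2 * complex_of_real (1 - real j / real (2 * N + 1 + 1)) - of_real (1 - real j / real (N + 1))) * c j"
      using that by (simp add: V_def coeff_fejer_mean left_diff_distrib del: of_real_diff)
    ultimately show ?thesis by simp
  qed
  show "coeff V 0 = c 0"
    by (simp add: coeffV)
  have summ: "summable (\<lambda>j. norm (c j))"
  proof -
    obtain x where "1 < x" "x < R" using dense R by blast
    then show ?thesis
      using powser_insidea[of c "of_real x" 1] sums_summable[OF sums[of "of_real x"]] by simp
  qed
  have f_eq: "(\<Sum>j. c j * z ^ j) = f z" if "norm z = 1" for z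
    using sums_unique[OF sums[of z]] that R by simp
  have V_le: "norm (poly V z) \<le> 3 * B" if "norm z = 1" for z
  proof -
    have "norm (poly (fejer_mean K c) z) \<le> B" for K
      using summ by (rule norm_fejer_mean_le) (simp_all add: f_eq bound that)
    from this[of N] this[of "2 * N + 1"] show ?thesis
      using norm_triangle_ineq4[of "2 * poly (fejer_mean (2 * N + 1) c) z" "poly (fejer_mean N c) z"]
      by (simp add: V_def norm_mult)
  qed
  show "norm (f z - poly V z) \<le> 4 * B * norm z ^ (N + 1)" if "norm z \<le> 1" for z
  proof (rule norm_power_series_le_of_order[OF R])
    show "(\<lambda>j. (c j - coeff V j) * z ^ j) sums (f z - poly V z)" if "norm z < R" for z
      unfolding left_diff_distrib
    proof (rule sums_diff[OF sums[OF that]])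
      show "(\<lambda>j. coeff V j * z ^ j) sums poly V z"
        unfolding poly_altdef by (rule sums_finite) (auto simp: coeff_eq_0)
    qed
    show "norm (f z - poly V z) \<le> 4 * B" if "norm z = 1" for z
      using norm_triangle_ineq4[of "f z" "poly V z"] bound[OF that] V_le[OF that] by simp
  qed (use that in \<open>auto simp: coeffV\<close>)
qed

section \<open>Polynomials that are small at given points of the circle\<close>

text \<open>The Herglotz kernel has nonnegative real part on the disc, so this function is bounded by \<open>e\<close>
  there, takes the value 1 at 0, and decays like $\exp(-1/(k(1-r)))$ as \<open>z\<close> approaches a point \<open>l i\<close>
  radially.\<close>

definition barrier :: "nat \<Rightarrow> (nat \<Rightarrow> complex) \<Rightarrow> complex \<Rightarrow> complex" where
  "barrier k l z = exp (1 - of_real (1 / real k) * (\<Sum>i=1..k. (1 + z * cnj (l i)) / (1 - z * cnj (l i))))"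

lemma Re_cayley:
  "Re ((1 + z) / (1 - z)) = (1 - (cmod z)\<^sup>2) / (cmod (1 - z))\<^sup>2"
  unfolding Re_divide cmod_power2 by (simp add: power2_eq_square algebra_simps)

lemma Re_cayley_nonneg: "norm z \<le> 1 \<Longrightarrow> Re ((1 + z) / (1 - z)) \<ge> 0"
  by (simp only: Re_cayley) (simp add: power_le_one)

lemma norm_barrier:
  "norm (barrier k l z) = exp (1 - (1 / real k) * (\<Sum>i=1..k. Re ((1 + z * cnj (l i)) / (1 - z * cnj (l i)))))"
  unfolding barrier_def norm_exp_eq_Re by simp

lemma barrier_0: "k \<ge> 1 \<Longrightarrow> barrier k l 0 = 1"
  by (simp add: barrier_def)

lemma norm_barrier_le:
  assumes "\<And>i. i \<in> {1..k} \<Longrightarrow> norm (l i) = 1" "norm z \<le> 1"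
  shows "norm (barrier k l z) \<le> exp 1"
proof -
  have "0 \<le> (\<Sum>i=1..k. Re ((1 + z * cnj (l i)) / (1 - z * cnj (l i))))"
  proof (intro sum_nonneg Re_cayley_nonneg)
    show "norm (z * cnj (l i)) \<le> 1" if "i \<in> {1..k}" for i
      using assms(1)[OF that] assms(2) by (simp add: norm_mult)
  qed
  then have "0 \<le> 1 / real k * (\<Sum>i=1..k. Re ((1 + z * cnj (l i)) / (1 - z * cnj (l i))))"
    by (intro mult_nonneg_nonneg) auto
  then show ?thesis
    unfolding norm_barrier by simp
qed

lemma norm_barrier_near_zero_le:
  assumes l: "\<And>i. i \<in> {1..k} \<Longrightarrow> norm (l i) = 1" and i: "i \<in> {1..k}" and r: "0 \<le> r" "r < 1"
  shows "norm (barrier k l (of_real r * l i)) \<le> exp (1 - 1 / (real k * (1 - r)))"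
proof -
  let ?h = "\<lambda>j. Re ((1 + of_real r * l i * cnj (l j)) / (1 - of_real r * l i * cnj (l j)))"
  have "l i * cnj (l i) = 1"
    using l[OF i] by (simp add: complex_norm_square[symmetric])
  then have "?h i = Re (of_real ((1 + r) / (1 - r)))"
    by (simp only: mult.assoc mult_1_right of_real_add of_real_diff of_real_divide of_real_1)
  then have "1 / (1 - r) \<le> ?h i"
    using r by (simp only: Re_complex_of_real) (simp add: divide_right_mono)
  also have "\<dots> \<le> (\<Sum>j=1..k. ?h j)"
  proof (rule member_le_sum)
    show "0 \<le> ?h j" if "j \<in> {1..k} - {i}" for j
    proof (rule Re_cayley_nonneg)
      show "norm (of_real r * l i * cnj (l j)) \<le> 1"
        using l[OF i] l[of j] that r by (simp add: norm_mult)
    qed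
  qed (use i in auto)
  finally have "1 / real k * (1 / (1 - r)) \<le> 1 / real k * (\<Sum>j=1..k. ?h j)"
    by (intro mult_left_mono) auto
  then show ?thesis
    unfolding norm_barrier by simp
qed

lemma holomorphic_barrier:
  assumes "\<And>i. i \<in> {1..k} \<Longrightarrow> norm (l i) = 1"
  shows "barrier k l holomorphic_on ball 0 1"
  unfolding barrier_def
proof (intro holomorphic_intros)
  fix i z assume "i \<in> {1..k}" "z \<in> ball (0::complex) 1"
  then have "norm (z * cnj (l i)) < 1"
    using assms by (simp add: norm_mult)
  then show "1 - z * cnj (l i) \<noteq> 0"
    by auto
qed

text \<open>Two dilations by \<open>\<rho>\<close> are used: the first makes the barrier analytic
  beyond the circle, the second moves the points into the disc, where the approximation error
  decays. At \<open>l i\<close> the barrier contributes at most \<open>exp 1 * exp (- L / 2)\<close>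
  and the error four times that.\<close>

lemma small_polynomial_at_points:
  fixes l :: "nat \<Rightarrow> complex" and L :: real
  assumes l: "\<And>i. i \<in> {1..k} \<Longrightarrow> norm (l i) = 1" and k: "k \<ge> 1" and L: "L > 1"
    and n: "real k * L\<^sup>2 \<le> real n"
  obtains Q :: "complex poly" where "degree Q \<le> n" "poly Q 0 = 1"
    "\<And>z. norm z = 1 \<Longrightarrow> norm (poly Q z) \<le> 5 * exp 1"
    "\<And>i. i \<in> {1..k} \<Longrightarrow> norm (poly Q (l i)) \<le> 5 * exp 1 * exp (- L / 2)"
proof -
  \<comment> \<open>This choice balances both contributions: 1 / (k (1 - \<rho>^2)) is at least L /
    2, and \<rho>^(n/2) is at most exp (- L / 2) once n is at least k L^2.\<close>
  define \<rho> where "\<rho> = 1 - 1 / (real k * L)"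
  have kL: "real k * L > 1"
    using k L mult_mono[of 1 "real k" 1 L] less_le_trans[of 1 L "real k * L"] by auto
  then have \<rho>: "0 < \<rho>" "\<rho> < 1"
    by (auto simp: \<rho>_def)
  have "n \<ge> 1" using k L n by (cases n) (auto simp: mult_le_0_iff)
  \<comment> \<open>The largest \<open>N\<close> for which a mean of degree \<open>2 * N + 1\<close>
    fits into degree \<open>n\<close>.\<close>
  define N where "N = (n - 1) div 2"
  have N: "2 * N + 1 \<le> n" "n \<le> 2 * (N + 1)"
    using \<open>n \<ge> 1\<close> by (auto simp: N_def)
  define c where "c j = (deriv ^^ j) (barrier k l) 0 / fact j * of_real \<rho> ^ j" for j
  have sums: "(\<lambda>j. c j * z ^ j) sums barrier k l (of_real \<rho> * z)" if "norm z < 1 / \<rho>" for z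
  proof -
    have "norm (of_real \<rho> * z) < 1"
      using that \<rho> by (simp add: norm_mult field_simps)
    then show ?thesis
      using holomorphic_power_series[OF holomorphic_barrier[OF l], where w = "of_real \<rho> * z"]
      by (simp add: c_def power_mult_distrib mult_ac)
  qed
  have bound: "norm (barrier k l (of_real \<rho> * z)) \<le> exp 1" if "norm z \<le> 1" for z
  proof (rule norm_barrier_le[OF l])
    show "norm (of_real \<rho> * z) \<le> 1"
      using that \<rho> mult_mono[of \<rho> 1 "norm z" 1] by (simp add: norm_mult)
  qed
  obtain V where V: "degree V \<le> 2 * N + 1" "coeff V 0 = c 0"
      "\<And>z. norm z \<le> 1 \<Longrightarrow> norm (barrier k l (of_real \<rho> * z) - poly V z) \<le> 4 * exp 1 * norm z ^ (N + 1)"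
  proof (rule bounded_power_series_approximation[where R = "1 / \<rho>" and c = c and B = "exp 1"
        and f = "\<lambda>z. barrier k l (of_real \<rho> * z)" and N = N])
    show "norm (barrier k l (of_real \<rho> * z)) \<le> exp 1" if "norm z = 1" for z
      using bound that by simp
  qed (use \<rho> sums in auto)
  have small: "\<rho> ^ (N + 1) \<le> exp (- L / 2)"
  proof -
    have "\<rho> \<le> exp (- 1 / (real k * L))"
      using exp_ge_add_one_self[of "- 1 / (real k * L)"] by (simp add: \<rho>_def)
    then have "\<rho> ^ (N + 1) \<le> exp (- 1 / (real k * L)) ^ (N + 1)"
      using \<rho> by (intro power_mono) auto
    also have "\<dots> = exp (- (real (N + 1) / (real k * L)))"
      by (subst exp_of_nat_mult[symmetric]) simp
    also have "\<dots> \<le> exp (- L / 2)"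
    proof -
      have "real k * L\<^sup>2 \<le> 2 * real (N + 1)"
        using n N(2) by linarith
      then have "L / 2 \<le> real (N + 1) / (real k * L)"
        using kL by (simp add: field_simps power2_eq_square)
      then show ?thesis by simp
    qed
    finally show ?thesis .
  qed
  show thesis
  proof (rule that[of "pcompose V [:0, of_real \<rho>:]"])
    show "degree (pcompose V [:0, of_real \<rho>:]) \<le> n"
      using V(1) N(1) \<rho> by (simp add: degree_pcompose)
    have "c 0 = 1"
      using k by (simp add: c_def barrier_0)
    then show "poly (pcompose V [:0, of_real \<rho>:]) 0 = 1"
      using V(2) by (simp add: poly_pcompose poly_0_coeff_0)
  next
    have near: "norm (poly V (of_real \<rho> * z)) \<le> norm (barrier k l (of_real \<rho> * (of_real \<rho> * z))) + 4 * exp 1 * \<rho> ^ (N + 1)"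
      if "norm z = 1" for z
      using V(3)[of "of_real \<rho> * z"] that \<rho>
        norm_triangle_ineq2[of "poly V (of_real \<rho> * z)" "barrier k l (of_real \<rho> * (of_real \<rho> * z))"]
      by (simp add: norm_mult norm_minus_commute)
    show "norm (poly (pcompose V [:0, of_real \<rho>:]) z) \<le> 5 * exp 1" if "norm z = 1" for z
    proof -
      have "4 * exp 1 * \<rho> ^ (N + 1) \<le> 4 * exp 1"
        using \<rho> power_le_one[of \<rho> "N + 1"] by simp
      moreover have "norm (barrier k l (of_real \<rho> * (of_real \<rho> * z))) \<le> exp 1"
        using that \<rho> by (intro bound) (simp add: norm_mult)
      moreover have "norm (poly (pcompose V [:0, of_real \<rho>:]) z) = norm (poly V (of_real \<rho> * z))"
        by (simp add: poly_pcompose mult.commute)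
      ultimately show ?thesis
        using near[OF that] by linarith
    qed
    show "norm (poly (pcompose V [:0, of_real \<rho>:]) (l i)) \<le> 5 * exp 1 * exp (- L / 2)"
      if i: "i \<in> {1..k}" for i
    proof -
      \<comment> \<open>After both dilations the barrier is evaluated at radius
        \<open>\<rho>\<^sup>2\<close>.\<close>
      have r: "0 \<le> \<rho>\<^sup>2" "\<rho>\<^sup>2 < 1"
        using \<rho> by (auto simp: power_less_one_iff)
      have "norm (barrier k l (of_real \<rho> * (of_real \<rho> * l i))) \<le> exp (1 - 1 / (real k * (1 - \<rho>\<^sup>2)))"
        using norm_barrier_near_zero_le[OF l i r] by (simp add: power2_eq_square mult.assoc)
      also have "\<dots> \<le> exp (1 - L / 2)"
      proof -
        have "1 - \<rho>\<^sup>2 = (1 - \<rho>) * (1 + \<rho>)"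
          by (simp add: power2_eq_square algebra_simps)
        also have "\<dots> \<le> (1 - \<rho>) * 2"
          using \<rho> by (intro mult_left_mono) auto
        finally have "real k * (1 - \<rho>\<^sup>2) \<le> real k * ((1 - \<rho>) * 2)"
          by (intro mult_left_mono) auto
        also have "\<dots> = 2 / L"
          using k L by (simp add: \<rho>_def)
        finally have "real k * (1 - \<rho>\<^sup>2) \<le> 2 / L" .
        moreover have "real k * (1 - \<rho>\<^sup>2) > 0"
          using k r by simp
        ultimately have "L / 2 \<le> 1 / (real k * (1 - \<rho>\<^sup>2))"
          using L by (simp add: field_simps)
        then show ?thesis by simp
      qed
      also have "\<dots> = exp 1 * exp (- L / 2)"
        by (simp flip: exp_add)
      finally have "norm (barrier k l (of_real \<rho> * (of_real \<rho> * l i))) \<le> exp 1 * exp (- L / 2)" .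
      moreover have "4 * exp 1 * \<rho> ^ (N + 1) \<le> 4 * exp 1 * exp (- L / 2)"
        using small by (intro mult_left_mono) auto
      moreover have "norm (poly (pcompose V [:0, of_real \<rho>:]) (l i)) = norm (poly V (of_real \<rho> * l i))"
        by (simp add: poly_pcompose mult.commute)
      ultimately show ?thesis
        using near[OF l[OF i]] by linarith
    qed
  qed
qed

section \<open>Polynomials with given zeros on the circle\<close>

text \<open>Needed for the value at 1 of a Fejer mean of a geometric series. Raising
  \<open>m\<close> by one adds an ordinary geometric sum.\<close>

lemma weighted_geometric_sum:
  fixes r :: real
  shows "(1 - r)\<^sup>2 * (\<Sum>j<m. real (m - j) * r ^ j) = real m * (1 - r) - r * (1 - r ^ m)"
proof (induction m)
  case (Suc m)
  have "(\<Sum>j<Suc m. real (Suc m - j) * r ^ j) = (\<Sum>j<Suc m. real (m - j) * r ^ j + r ^ j)"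
    by (intro sum.cong refl) (auto simp: Suc_diff_le algebra_simps)
  also have "\<dots> = (\<Sum>j<m. real (m - j) * r ^ j) + (\<Sum>j<Suc m. r ^ j)"
    by (simp add: sum.distrib)
  finally have "(1 - r)\<^sup>2 * (\<Sum>j<Suc m. real (Suc m - j) * r ^ j)
      = (1 - r)\<^sup>2 * (\<Sum>j<m. real (m - j) * r ^ j) + (1 - r) * ((1 - r) * (\<Sum>j<Suc m. r ^ j))"
    by (simp add: distrib_left power2_eq_square mult.assoc)
  also have "(1 - r) * (\<Sum>j<Suc m. r ^ j) = 1 - r ^ Suc m"
    by (rule one_diff_power_eq[symmetric])
  finally show ?case
    by (simp only: Suc.IH) (simp add: algebra_simps)
qed simp

text \<open>The function is (1 - (r + s) z) / (1 - r z). On the circle |1 - c z|^2 is affine in Re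
  z, so numerator and denominator need comparing only at z = 1 and z = -1.\<close>

lemma norm_moebius_le:
  fixes z :: complex
  assumes z: "norm z = 1" and r: "0 \<le> r" "r < 1" and s: "0 \<le> s" "s \<le> 2 * (1 - r)"
  shows "norm (1 - of_real s * z / (1 - of_real r * z)) \<le> 1 + 2 * (1 - r) / (1 + r)"
proof -
  \<comment> \<open>This is (3 - r) / (1 + r), the value of the quotient at -1 in the extreme case s
    = 2 (1 - r).\<close>
  define M where "M = 1 + 2 * (1 - r) / (1 + r)"
  have norm_sq: "(cmod (1 - of_real c * z))\<^sup>2
      = (1 + Re z) / 2 * (1 - c)\<^sup>2 + (1 - Re z) / 2 * (1 + c)\<^sup>2" for c :: real
  proof -
    have "(cmod (1 - of_real c * z))\<^sup>2 = 1 - 2 * c * Re z + c\<^sup>2 * (cmod z)\<^sup>2"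
      unfolding cmod_power2 by (simp add: power2_eq_square algebra_simps)
    then show ?thesis
      by (simp add: z power2_eq_square field_simps)
  qed
  have M1: "M \<ge> 1" and Mr: "M * (1 + r) = 3 - r"
    using r by (auto simp: M_def field_simps)
  have Re: "\<bar>Re z\<bar> \<le> 1"
    using abs_Re_le_cmod[of z] z by simp
  have "\<bar>1 - (r + s)\<bar> \<le> 1 - r"
    using s by (intro abs_leI) auto
  also have "\<dots> \<le> M * (1 - r)"
    using M1 r mult_right_mono[OF M1, of "1 - r"] by simp
  finally have 1: "(1 - (r + s))\<^sup>2 \<le> (M * (1 - r))\<^sup>2"
    by (rule abs_le_square_iff[THEN iffD1, OF order_trans]) simp
  have 2: "(1 + (r + s))\<^sup>2 \<le> (M * (1 + r))\<^sup>2"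
    unfolding Mr using r s by (intro power_mono) auto
  have "(cmod (1 - of_real (r + s) * z))\<^sup>2
      \<le> (1 + Re z) / 2 * (M * (1 - r))\<^sup>2 + (1 - Re z) / 2 * (M * (1 + r))\<^sup>2"
    unfolding norm_sq using 1 2 Re by (intro add_mono mult_left_mono) auto
  also have "\<dots> = (M * cmod (1 - of_real r * z))\<^sup>2"
    unfolding power_mult_distrib norm_sq by (simp only: distrib_left mult_ac)
  finally have le: "cmod (1 - of_real (r + s) * z) \<le> M * cmod (1 - of_real r * z)"
    by (rule power2_le_imp_le) (use M1 in simp)
  have nz: "1 - of_real r * z \<noteq> 0"
  proof
    assume "1 - of_real r * z = 0"
    then have "norm (of_real r * z) = 1"
      by (metis norm_one right_minus_eq)
    then show False
      using z r by (simp add: norm_mult)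
  qed
  have "1 - of_real (r + s) * z = (1 - of_real r * z) - of_real s * z"
    by (simp add: algebra_simps)
  then have "1 - of_real s * z / (1 - of_real r * z) = (1 - of_real (r + s) * z) / (1 - of_real r * z)"
    by (simp only: diff_divide_distrib[of "1 - of_real r * z"] divide_self[OF nz])
  then show ?thesis
    using le nz by (simp only: M_def[symmetric] norm_divide divide_le_eq zero_less_norm_iff not_False_eq_True if_True)
qed

lemma polynomial_with_zero_at_1:
  assumes m: "m \<ge> 1"
  obtains P :: "complex poly" where "degree P \<le> m" "poly P 0 = 1" "poly P 1 = 0"
    "\<And>z. norm z = 1 \<Longrightarrow> norm (poly P z) \<le> 1 + 2 / real m"
proof -
  \<comment> \<open>\<open>P\<close> is a Fejer mean of $1 - sz/(1-rz)$, with \<open>s\<close> chosen to make it vanish at 1.\<close>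
  define r where "r = (real m - 1) / (real m + 1)"
  have r: "0 \<le> r" "r < 1" and r1: "1 - r = 2 / (real m + 1)" "1 + r = 2 * real m / (real m + 1)"
    using m by (auto simp: r_def field_simps)
  \<comment> \<open>The Fejer mean will take the value 1 - s S at 1, which forces s = 1 / S. The
    bound on \<open>S\<close> below is exactly the condition s \<le> 2 (1 - r) of the Moebius
    estimate.\<close>
  define S where "S = (\<Sum>j<m. real (m - j) * r ^ j) / (real m + 1)"
  have S_ge: "S \<ge> (real m + 1) / 4"
  proof -
    have "r * (1 - r ^ m) \<le> r"
      using r by (simp add: mult_left_le)
    then have "1 \<le> (1 - r)\<^sup>2 * (\<Sum>j<m. real (m - j) * r ^ j)"
      unfolding weighted_geometric_sum r1 r_def by (simp add: field_simps)
    also have "\<dots> = 4 / (real m + 1) * S"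
      unfolding r1 S_def by (simp add: power2_eq_square field_simps)
    finally show ?thesis
      by (simp add: field_simps)
  qed
  then have S_pos: "S > 0"
    by (rule less_le_trans[rotated]) simp
  define s where "s = 1 / S"
  have s: "0 \<le> s" "s \<le> 2 * (1 - r)"
    using S_ge S_pos unfolding r1 s_def by (auto simp: field_simps)
  define c :: "nat \<Rightarrow> complex" where "c j = (case j of 0 \<Rightarrow> 1 | Suc i \<Rightarrow> - of_real (s * r ^ i))" for j
  have c_sums: "(\<lambda>j. c j * z ^ j) sums (1 - of_real s * z / (1 - of_real r * z))" if "norm z = 1" for z
  proof -
    have "norm (of_real r * z) < 1"
      using that r by (simp add: norm_mult)
    then have "(\<lambda>j. - of_real s * z * (of_real r * z) ^ j) sums (- of_real s * z * (1 / (1 - of_real r * z)))"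
      by (intro sums_mult geometric_sums)
    then have "(\<lambda>j. c (Suc j) * z ^ Suc j) sums (- of_real s * z / (1 - of_real r * z))"
      by (simp add: c_def power_mult_distrib mult_ac)
    then show ?thesis
      by (subst (asm) sums_Suc_iff) (simp add: c_def)
  qed
  have c_summable: "summable (\<lambda>j. norm (c j))"
  proof -
    have "summable (\<lambda>j. s * r ^ j)"
      using r by (intro summable_mult summable_geometric) auto
    then have "summable (\<lambda>j. norm (c (Suc j)))"
      using s r by (simp add: c_def norm_mult norm_power)
    then show ?thesis
      by (subst (asm) summable_Suc_iff)
  qed
  show thesis
  proof (rule that[of "fejer_mean m c"])
    show "degree (fejer_mean m c) \<le> m"
      by (rule degree_fejer_mean)
    show "poly (fejer_mean m c) 0 = 1"
      by (simp add: poly_0_coeff_0 coeff_fejer_mean c_def)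
    show "norm (poly (fejer_mean m c) z) \<le> 1 + 2 / real m" if "norm z = 1" for z
      using c_summable _ that
    proof (rule norm_fejer_mean_le)
      fix z :: complex
      assume z: "norm z = 1"
      \<comment> \<open>The choice of \<open>r\<close> turns the excess in the Moebius estimate into
        2 / m.\<close>
      have "2 * (1 - r) = 2 / real m * (1 + r)"
        unfolding r1 using m by simp
      then have "2 * (1 - r) / (1 + r) = 2 / real m"
        using r by (simp add: divide_eq_eq)
      then show "norm (\<Sum>j. c j * z ^ j) \<le> 1 + 2 / real m"
        using norm_moebius_le[OF z r s] sums_unique[OF c_sums[OF z]] by simp
    qed
    have "poly (fejer_mean m c) 1 = (\<Sum>j<Suc m. of_real (1 - real j / real (m + 1)) * c j)"
      by (simp add: poly_fejer_mean lessThan_Suc_atMost)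
    also have "\<dots> = 1 - of_real (\<Sum>j<m. (1 - real (Suc j) / real (m + 1)) * (s * r ^ j))"
      by (subst sum.lessThan_Suc_shift) (simp add: c_def sum_negf)
    also have "(\<Sum>j<m. (1 - real (Suc j) / real (m + 1)) * (s * r ^ j))
        = (\<Sum>j<m. s / (real m + 1) * (real (m - j) * r ^ j))"
      by (intro sum.cong refl) (auto simp: of_nat_diff field_simps)
    also have "\<dots> = s * S"
      unfolding sum_distrib_left[symmetric] by (simp add: S_def)
    finally show "poly (fejer_mean m c) 1 = 0"
      using S_pos by (simp add: s_def)
  qed
qed

lemma polynomial_with_zeros_on_circle:
  fixes l :: "nat \<Rightarrow> complex"
  assumes l: "\<And>i. i \<in> {1..k} \<Longrightarrow> norm (l i) = 1" and k: "k \<ge> 1" "k \<le> n"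
  obtains Q :: "complex poly" where "degree Q \<le> n" "poly Q 0 = 1"
    "\<And>i. i \<in> {1..k} \<Longrightarrow> poly Q (l i) = 0"
    "\<And>z. norm z = 1 \<Longrightarrow> norm (poly Q z) \<le> exp (4 * (real k)\<^sup>2 / real n)"
proof -
  define m where "m = n div k"
  have m: "m \<ge> 1" and km: "k * m \<le> n"
    using k by (auto simp: m_def div_greater_zero_iff Suc_le_eq)
  \<comment> \<open>Rounding down in \<open>n div k\<close> costs at most a factor 2, whence 4
    instead of 2 in the exponent.\<close>
  have "n < k * (m + 1)"
    using k dividend_less_times_div[of k n] by (simp add: m_def)
  also have "\<dots> \<le> 2 * k * m"
    using m by (simp add: algebra_simps)
  finally have n_le: "real n \<le> 2 * real k * real m"
    by (metis less_imp_le of_nat_le_iff of_nat_mult of_nat_numeral)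
  obtain P :: "complex poly" where P: "degree P \<le> m" "poly P 0 = 1" "poly P 1 = 0"
      "\<And>z. norm z = 1 \<Longrightarrow> norm (poly P z) \<le> 1 + 2 / real m"
    using polynomial_with_zero_at_1[OF m] by blast
  \<comment> \<open>Composing with the rotation by \<open>cnj (l i)\<close> moves the zero from 1 to
    \<open>l i\<close> and fixes the value at 0.\<close>
  define Q where "Q = (\<Prod>i=1..k. pcompose P [:0, cnj (l i):])"
  have poly_Q: "poly Q z = (\<Prod>i=1..k. poly P (z * cnj (l i)))" for z
    by (simp add: Q_def poly_prod poly_pcompose mult.commute)
  show thesis
  proof (rule that[of Q])
    have "degree Q \<le> (\<Sum>i=1..k. degree (pcompose P [:0, cnj (l i):]))"
      unfolding Q_def using degree_prod_sum_le[of "{1..k}" "\<lambda>i. pcompose P [:0, cnj (l i):]"] by (simp add: o_def)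
    also have "\<dots> \<le> (\<Sum>i=1..k. m)"
      using P(1) by (intro sum_mono) (simp add: degree_pcompose)
    finally show "degree Q \<le> n"
      using km by simp
    show "poly Q 0 = 1"
      by (simp add: poly_Q P(2))
    show "poly Q (l i) = 0" if i: "i \<in> {1..k}" for i
    proof -
      have "l i * cnj (l i) = 1"
        using l[OF i] by (simp add: complex_norm_square[symmetric])
      then show ?thesis
        using i P(3) by (auto simp: poly_Q intro!: bexI[of _ i])
    qed
    show "norm (poly Q z) \<le> exp (4 * (real k)\<^sup>2 / real n)" if z: "norm z = 1" for z
    proof -
      have "norm (poly Q z) \<le> (\<Prod>i=1..k. exp (2 / real m))"
        unfolding poly_Q prod_norm[symmetric]
      proof (intro prod_mono conjI)
        fix i assume "i \<in> {1..k}"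
        then have "norm (poly P (z * cnj (l i))) \<le> 1 + 2 / real m"
          using l z by (intro P(4)) (simp add: norm_mult)
        also have "\<dots> \<le> exp (2 / real m)"
          by (rule exp_ge_add_one_self)
        finally show "norm (poly P (z * cnj (l i))) \<le> exp (2 / real m)" .
      qed simp
      also have "\<dots> = exp (2 * real k / real m)"
        by (simp flip: exp_of_nat_mult)
      also have "\<dots> \<le> exp (4 * (real k)\<^sup>2 / real n)"
      proof -
        have "2 * real k * real n \<le> 2 * real k * (2 * real k * real m)"
          using n_le by (intro mult_left_mono) auto
        then show ?thesis
          using k m by (simp add: field_simps power2_eq_square)
      qed
      finally show ?thesis .
    qed
  qed
qed

section \<open>Atomic measures\<close>

lemma weight_seqD:
  assumes "weight_seq a"
  shows "j \<ge> 1 \<Longrightarrow> a j > 0" "a summable_on {1..}" "infsum a {1..} = 1"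
  using assms by (auto simp: weight_seq_def has_sum_imp_summable infsumI)

lemma summable_on_weight_mult:
  assumes a: "weight_seq a" and g: "\<And>j. j \<ge> 1 \<Longrightarrow> \<bar>g j\<bar> \<le> B"
  shows "(\<lambda>j. norm (a j * g j)) summable_on {1..}"
proof (rule Infinite_Sum.abs_summable_on_comparison_test)
  show "(\<lambda>j. norm (B * a j)) summable_on {1..}"
  proof -
    have "(\<lambda>j. \<bar>B\<bar> * a j) summable_on {1..}"
      by (intro summable_on_cmult_right weight_seqD(2)[OF a])
    also have "(\<lambda>j. \<bar>B\<bar> * a j) summable_on {1..} \<longleftrightarrow> (\<lambda>j. norm (B * a j)) summable_on {1..}"
    proof (rule summable_on_cong)
      fix j :: nat assume "j \<in> {1..}"
      then show "\<bar>B\<bar> * a j = norm (B * a j)"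
        using weight_seqD(1)[OF a, of j] by (simp add: abs_mult)
    qed
    finally show ?thesis .
  qed
next
  fix j :: nat assume "j \<in> {1..}"
  then have "a j > 0" "\<bar>g j\<bar> \<le> \<bar>B\<bar>"
    using weight_seqD(1)[OF a, of j] g[of j] by auto
  then show "norm (a j * g j) \<le> norm (B * a j)"
    by (simp add: abs_mult mult.commute)
qed

text \<open>Continuity on the compact circle gives measurability and boundedness. The integral is
  then pulled back to the index set, where it becomes an absolutely convergent sum.\<close>

lemma integral_atomic_measure:
  fixes g :: "complex \<Rightarrow> real"
  assumes a: "weight_seq a" and l: "l \<in> {1..} \<rightarrow> sphere 0 1"
    and g: "continuous_on (sphere 0 1) g"
  shows "(\<lambda>j. a j * g (l j)) summable_on {1..}"
    and "(LINT t|atomic_measure a l. g t) = (\<Sum>\<^sub>\<infinity>j\<in>{1..}. a j * g (l j))"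
proof -
  have "bounded (g ` sphere 0 1)"
    using g by (intro compact_imp_bounded compact_continuous_image) auto
  then obtain B where B: "\<And>t. t \<in> sphere 0 1 \<Longrightarrow> \<bar>g t\<bar> \<le> B"
    unfolding bounded_iff ball_simps real_norm_def by blast
  have abs: "(\<lambda>j. norm (a j * g (l j))) summable_on {1..}"
    using l by (intro summable_on_weight_mult[OF a, of _ B] B) auto
  then show "(\<lambda>j. a j * g (l j)) summable_on {1..}"
    by (rule Infinite_Sum.abs_summable_summable)
  have gm: "g \<in> borel_measurable circle_borel"
    using g by (rule borel_measurable_continuous_on_restrict)
  have lm: "l \<in> measurable (density (count_space {1..}) (\<lambda>j. ennreal (a j))) circle_borel"
    using l by (auto simp: measurable_restrict_space2_iff)
  have "(LINT t|atomic_measure a l. g t) = (LINT j|density (count_space {1..}) (\<lambda>j. ennreal (a j)). g (l j))"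
    unfolding atomic_measure_def by (rule integral_distr[OF lm gm])
  also have "\<dots> = (LINT j|count_space {1..}. a j * g (l j))"
    using weight_seqD(1)[OF a] by (intro integral_real_density) (auto simp: AE_count_space less_imp_le)
  also have "\<dots> = infsetsum (\<lambda>j. a j * g (l j)) {1..}"
    by (simp add: infsetsum_def)
  also have "\<dots> = (\<Sum>\<^sub>\<infinity>j\<in>{1..}. a j * g (l j))"
    by (rule infsetsum_infsum[OF abs_summable_equivalent[THEN iffD1, OF abs]])
  finally show "(LINT t|atomic_measure a l. g t) = (\<Sum>\<^sub>\<infinity>j\<in>{1..}. a j * g (l j))" .
qed

lemma tail_sum_eq:
  assumes "weight_seq a"
  shows "(\<Sum>i=1..k. a i) + tail_sum a k = 1"
proof -
  have "{1..} = {1..k} \<union> {k<..}"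
    by auto
  moreover have "infsum a ({1..k} \<union> {k<..}) = infsum a {1..k} + infsum a {k<..}"
    by (rule infsum_Un_disjoint) (auto intro: summable_on_subset_banach[OF weight_seqD(2)[OF assms]])
  ultimately show ?thesis
    using weight_seqD(3)[OF assms] by (simp add: tail_sum_def)
qed

text \<open>Positive weights keep the tail strictly between 0 and 1, so its logarithm is strictly
  negative.\<close>

lemma tail_sum_bounds:
  assumes a: "weight_seq a" and k: "k \<ge> 1"
  shows "0 < tail_sum a k" "tail_sum a k < 1"
proof -
  have "0 < a (Suc k)"
    using weight_seqD(1)[OF a] by simp
  also have "a (Suc k) = infsum a {Suc k}"
    by simp
  also have "\<dots> \<le> infsum a {k<..}"
    using weight_seqD(1)[OF a]
    by (intro infsum_mono2 summable_on_subset_banach[OF weight_seqD(2)[OF a]]) (auto intro: less_imp_le)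
  finally show "0 < tail_sum a k"
    by (simp add: tail_sum_def)
  have "0 < (\<Sum>i=1..k. a i)"
    using k weight_seqD(1)[OF a] by (intro sum_pos) auto
  then show "tail_sum a k < 1"
    using tail_sum_eq[OF a, of k] by simp
qed

section \<open>Upper bounds for e_n from test polynomials, and passage to the supremum\<close>

lemma szego_e_sq:
  "(szego_e n \<rho>)\<^sup>2 = (INF q :: nat \<Rightarrow> complex. LINT t|\<rho>. (cmod (t ^ n + (\<Sum>i<n. q i * t ^ i)))\<^sup>2)"
  unfolding szego_e_def by (rule real_sqrt_pow2) (auto intro!: cINF_greatest integral_nonneg_AE)

lemma szego_e_nonneg: "0 \<le> szego_e n \<rho>"
  unfolding szego_e_def by (auto intro!: cINF_greatest integral_nonneg_AE)

text \<open>On the circle a monic polynomial of degree \<open>n\<close> has the same modulus as its reciprocal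
  polynomial, which takes the value 1 at the origin.\<close>

lemma szego_e_sq_le_integral:
  fixes Q :: "complex poly"
  assumes Q: "degree Q \<le> n" "poly Q 0 = 1" and a: "weight_seq a" and l: "l \<in> {1..} \<rightarrow> sphere 0 1"
  shows "(szego_e n (atomic_measure a l))\<^sup>2 \<le> (\<Sum>\<^sub>\<infinity>j\<in>{1..}. a j * (cmod (poly Q (l j)))\<^sup>2)"
proof -
  let ?M = "atomic_measure a l"
  \<comment> \<open>Coefficients of the reciprocal polynomial; at \<open>i = n\<close> the formula
    gives the conjugate of Q(0), which is 1, so the polynomial is monic.\<close>
  let ?q = "\<lambda>i. cnj (coeff Q (n - i))"
  have "(szego_e n ?M)\<^sup>2 \<le> (LINT t|?M. (cmod (t ^ n + (\<Sum>i<n. ?q i * t ^ i)))\<^sup>2)"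
    unfolding szego_e_sq
    by (rule cINF_lower) (auto intro!: bdd_belowI2[where m = 0] integral_nonneg_AE)
  also have "\<dots> = (LINT t|?M. (cmod (poly Q t))\<^sup>2)"
  proof (rule Bochner_Integration.integral_cong)
    fix t assume "t \<in> space ?M"
    then have t: "norm t = 1"
      by (simp add: atomic_measure_def space_restrict_space)
    then have tt: "t * cnj t = 1"
      by (simp add: complex_norm_square[symmetric])
    have "t ^ n + (\<Sum>i<n. ?q i * t ^ i) = (\<Sum>i\<le>n. ?q i * t ^ i)"
      using Q(2) by (simp add: poly_0_coeff_0 flip: lessThan_Suc_atMost)
    also have "\<dots> = (\<Sum>i\<le>n. cnj (coeff Q i) * t ^ (n - i))"
      by (rule sum.reindex_bij_witness[where i = "\<lambda>i. n - i" and j = "\<lambda>i. n - i"]) auto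
    also have "\<dots> = (\<Sum>i\<le>n. t ^ n * cnj (coeff Q i * t ^ i))"
    proof (intro sum.cong refl)
      fix i assume "i \<in> {..n}"
      then have "t ^ n * cnj t ^ i = t ^ (n - i) * (t * cnj t) ^ i"
        unfolding power_mult_distrib by (simp add: mult.assoc[symmetric] flip: power_add)
      then show "cnj (coeff Q i) * t ^ (n - i) = t ^ n * cnj (coeff Q i * t ^ i)"
        by (simp add: tt mult_ac)
    qed
    also have "\<dots> = t ^ n * cnj (\<Sum>i\<le>n. coeff Q i * t ^ i)"
      by (simp only: sum_distrib_left[symmetric] cnj_sum)
    also have "(\<Sum>i\<le>n. coeff Q i * t ^ i) = poly Q t"
      unfolding poly_altdef using Q(1)
      by (intro sum.mono_neutral_right) (auto simp: coeff_eq_0)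
    finally show "(cmod (t ^ n + (\<Sum>i<n. ?q i * t ^ i)))\<^sup>2 = (cmod (poly Q t))\<^sup>2"
      by (simp add: norm_mult norm_power t)
  qed simp
  also have "\<dots> = (\<Sum>\<^sub>\<infinity>j\<in>{1..}. a j * (cmod (poly Q (l j)))\<^sup>2)"
    by (rule integral_atomic_measure(2)[OF a l]) (intro continuous_intros)
  finally show ?thesis .
qed

text \<open>The first \<open>k\<close> atoms have total mass at most 1 and the remaining ones have
  mass \<open>tail_sum a k\<close>.\<close>

lemma szego_e_sq_le:
  fixes Q :: "complex poly"
  assumes Q: "degree Q \<le> n" "poly Q 0 = 1" and a: "weight_seq a" and l: "l \<in> {1..} \<rightarrow> sphere 0 1"
    and A: "\<And>i. i \<in> {1..k} \<Longrightarrow> norm (poly Q (l i)) \<le> A"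
    and B: "\<And>z. norm z = 1 \<Longrightarrow> norm (poly Q z) \<le> B"
  shows "(szego_e n (atomic_measure a l))\<^sup>2 \<le> A\<^sup>2 + B\<^sup>2 * tail_sum a k"
proof -
  let ?f = "\<lambda>j. a j * (cmod (poly Q (l j)))\<^sup>2"
  have sum_f: "?f summable_on {1..}"
    by (rule integral_atomic_measure(1)[OF a l]) (intro continuous_intros)
  have summ: "?f summable_on {1..k}" "?f summable_on {k<..}"
    by (auto intro: summable_on_subset_banach[OF sum_f])
  have "{1..} = {1..k} \<union> {k<..}" "{1..k} \<inter> {k<..} = {}"
    by auto
  then have "infsum ?f {1..} = infsum ?f {1..k} + infsum ?f {k<..}"
    using infsum_Un_disjoint[OF summ] by simp
  also have "infsum ?f {1..k} \<le> A\<^sup>2"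
  proof -
    have "infsum ?f {1..k} = (\<Sum>j=1..k. ?f j)"
      by simp
    also have "\<dots> \<le> (\<Sum>j=1..k. a j * A\<^sup>2)"
      using A weight_seqD(1)[OF a] by (intro sum_mono mult_left_mono power_mono) (auto intro: less_imp_le)
    also have "\<dots> = (\<Sum>j=1..k. a j) * A\<^sup>2"
      by (rule sum_distrib_right[symmetric])
    also have "\<dots> \<le> 1 * A\<^sup>2"
    proof (rule mult_right_mono)
      have "0 \<le> tail_sum a k"
        unfolding tail_sum_def using weight_seqD(1)[OF a] by (intro infsum_nonneg) (auto intro: less_imp_le)
      then show "(\<Sum>j=1..k. a j) \<le> 1"
        using tail_sum_eq[OF a, of k] by simp
    qed simp
    finally show ?thesis by simp
  qed
  also have "infsum ?f {k<..} \<le> (\<Sum>\<^sub>\<infinity>j\<in>{k<..}. B\<^sup>2 * a j)"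
  proof (rule infsum_mono[OF summ(2)])
    show "(\<lambda>j. B\<^sup>2 * a j) summable_on {k<..}"
      by (intro summable_on_cmult_right summable_on_subset_banach[OF weight_seqD(2)[OF a]]) auto
    show "?f j \<le> B\<^sup>2 * a j" if "j \<in> {k<..}" for j
    proof -
      have "norm (l j) = 1"
        using funcset_mem[OF l, of j] that by simp
      then have "(cmod (poly Q (l j)))\<^sup>2 \<le> B\<^sup>2"
        by (intro power_mono B) auto
      then show ?thesis
        using weight_seqD(1)[OF a, of j] that by (simp add: mult.commute mult_left_mono)
    qed
  qed
  also have "\<dots> = B\<^sup>2 * tail_sum a k"
    by (simp add: infsum_cmult_right' tail_sum_def)
  finally have "infsum ?f {1..} \<le> A\<^sup>2 + B\<^sup>2 * tail_sum a k"
    by simp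
  then show ?thesis
    using szego_e_sq_le_integral[OF Q a l] by linarith
qed

lemma const_1_in_circle_seqs: "(\<lambda>_. 1) \<in> {1..} \<rightarrow> sphere (0::complex) 1"
  by simp

text \<open>The constant sequence 1 shows that \<open>X\<close> and the supremum are nonnegative, so
  roots can be taken and squared back.\<close>

lemma szego_e_star_sq_le:
  assumes "\<And>l. l \<in> {1..} \<rightarrow> sphere 0 1 \<Longrightarrow> (szego_e n (atomic_measure a l))\<^sup>2 \<le> X"
    and a: "weight_seq a"
  shows "(szego_e_star n a)\<^sup>2 \<le> X"
proof -
  have X: "0 \<le> X"
    using assms(1)[of "\<lambda>_. 1"] order_trans[OF zero_le_power2] by auto
  have "szego_e_star n a \<le> sqrt X"
    unfolding szego_e_star_def
    using assms(1) const_1_in_circle_seqs by (intro cSUP_least) (auto intro: real_le_rsqrt)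
  moreover have "0 \<le> szego_e_star n a"
    unfolding szego_e_star_def
    using cSUP_upper2[OF bdd_above_szego_e[OF a] const_1_in_circle_seqs szego_e_nonneg] .
  ultimately have "(szego_e_star n a)\<^sup>2 \<le> (sqrt X)\<^sup>2"
    by (intro power_mono)
  then show ?thesis
    using X by simp
qed

lemma szego_e_star_sq_ge:
  assumes a: "weight_seq a" and l: "l \<in> {1..} \<rightarrow> sphere 0 1"
  shows "(szego_e n (atomic_measure a l))\<^sup>2 \<le> (szego_e_star n a)\<^sup>2"
  unfolding szego_e_star_def
  by (intro power_mono szego_e_nonneg cSUP_upper bdd_above_szego_e[OF a] l)

section \<open>The three estimates\<close>

text \<open>The indices are cut into blocks of length \<open>n + 1\<close>. Each block visits every
  root of unity once, and each of its weights is at least the last one,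
  \<open>a (Suc i * W)\<close>.\<close>

lemma szego_e_star_sq_ge_progression_sum:
  assumes a: "weight_seq a" and mono: "antimono_on {1..} a"
  shows "real (n + 1) * (\<Sum>\<^sub>\<infinity>j\<in>{1..}. a (j * (n + 1))) \<le> (szego_e_star n a)\<^sup>2"
proof -
  define W where "W = n + 1"
  have W: "W > 0"
    by (simp add: W_def)
  define l where "l j = cis (2 * pi * real j / real W)" for j :: nat
  have l: "l \<in> {1..} \<rightarrow> sphere 0 1"
    by (auto simp: l_def)
  have periodic: "l (j + i * W) = l j" for i j
  proof -
    have "l (j + i * W) = cis (2 * pi * real j / real W + 2 * pi * real i)"
      using W by (simp add: l_def add_divide_distrib distrib_left mult.assoc)
    also have "\<dots> = l j * cis (2 * pi * real i)"
      unfolding l_def cis_mult ..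
    also have "cis (2 * pi * real i) = 1"
      by (rule cis_multiple_2pi) simp
    finally show ?thesis
      by simp
  qed
  have Suc_bij: "bij_betw Suc UNIV {1..}"
    by (rule bij_betwI[of _ _ _ "\<lambda>n. n - 1"]) auto
  have mult_summable: "(\<lambda>i. a (Suc i * W)) summable_on UNIV"
  proof -
    have "a summable_on (\<lambda>i. Suc i * W) ` UNIV"
      using W by (intro summable_on_subset_banach[OF weight_seqD(2)[OF a]]) auto
    moreover have "inj (\<lambda>i. Suc i * W)"
      using W by (auto simp: inj_def)
    ultimately show ?thesis
      using summable_on_reindex by (auto simp: o_def)
  qed
  then have mult_sums: "(\<lambda>i. a (Suc i * W)) sums (\<Sum>\<^sub>\<infinity>j\<in>{1..}. a (j * W))"
    using has_sum_imp_sums[OF has_sum_infsum[OF mult_summable]] infsum_reindex_bij_betw[OF Suc_bij, of "\<lambda>j. a (j * W)"]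
    by simp
  have "real W * (\<Sum>\<^sub>\<infinity>j\<in>{1..}. a (j * W))
      \<le> (LINT t|atomic_measure a l. (cmod (t ^ n + (\<Sum>i<n. q i * t ^ i)))\<^sup>2)" for q :: "nat \<Rightarrow> complex"
  proof -
    \<comment> \<open>Including the leading coefficient gives \<open>W\<close> coefficients, as many
      as there are roots; the leading one alone makes the Parseval sum at least 1.\<close>
    define b where "b i = (if i = n then 1 else q i)" for i
    define g where "g t = (cmod (\<Sum>i<W. b i * t ^ i))\<^sup>2" for t
    have g_eq: "(cmod (t ^ n + (\<Sum>i<n. q i * t ^ i)))\<^sup>2 = g t" for t
      by (simp add: g_def W_def b_def add.commute)
    have g_sum: "(\<Sum>j\<in>{i * W..<i * W + W}. g (l (Suc j))) \<ge> real W" for i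
    proof -
      have "(\<Sum>j\<in>{i * W..<i * W + W}. g (l (Suc j))) = (\<Sum>j<W. g (l (Suc j)))"
      proof (rule sum.reindex_bij_witness[where i = "\<lambda>j. j + i * W" and j = "\<lambda>j. j - i * W"])
        show "g (l (Suc (j - i * W))) = g (l (Suc j))" if "j \<in> {i * W..<i * W + W}" for j
          using periodic[of "Suc (j - i * W)" i] that by simp
      qed auto
      \<comment> \<open>A block runs over the indices 1 to \<open>W\<close> rather than 0 to
        \<open>W - 1\<close>; by periodicity \<open>l W = l 0\<close>.\<close>
      also have "\<dots> = (\<Sum>j<W. g (l j))"
      proof -
        have "(\<Sum>j<W. g (l (Suc j))) + g (l 0) = (\<Sum>j<W. g (l j)) + g (l W)"
          using sum.lessThan_Suc[of "\<lambda>j. g (l j)" W] sum.lessThan_Suc_shift[of "\<lambda>j. g (l j)" W] by simp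
        then show ?thesis
          using periodic[of 0 1] by simp
      qed
      also have "\<dots> = real W * (\<Sum>j<W. (cmod (b j))\<^sup>2)"
        unfolding g_def l_def by (rule parseval_roots_of_unity)
      also have "\<dots> \<ge> real W * 1"
      proof (rule mult_left_mono)
        have "(cmod (b n))\<^sup>2 \<le> (\<Sum>j<W. (cmod (b j))\<^sup>2)"
          by (rule member_le_sum) (auto simp: W_def)
        then show "1 \<le> (\<Sum>j<W. (cmod (b j))\<^sup>2)"
          by (simp add: b_def)
      qed simp
      finally show ?thesis by simp
    qed
    have cont: "continuous_on (sphere 0 1) g"
      unfolding g_def by (intro continuous_intros)
    have "(\<lambda>j. a (Suc j) * g (l (Suc j))) sums (\<Sum>\<^sub>\<infinity>j\<in>{1..}. a j * g (l j))"
      using has_sum_infsum[OF integral_atomic_measure(1)[OF a l cont]]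
      by (intro has_sum_imp_sums) (simp add: has_sum_reindex_bij_betw[OF Suc_bij, of "\<lambda>j. a j * g (l j)"])
    then have sums2: "(\<lambda>i. \<Sum>j\<in>{i * W..<i * W + W}. a (Suc j) * g (l (Suc j))) sums (\<Sum>\<^sub>\<infinity>j\<in>{1..}. a j * g (l j))"
      using W by (rule sums_group)
    have sums1: "(\<lambda>i. real W * a (Suc i * W)) sums (real W * (\<Sum>\<^sub>\<infinity>j\<in>{1..}. a (j * W)))"
      by (intro sums_mult mult_sums)
    have block: "real W * a (Suc i * W) \<le> (\<Sum>j\<in>{i * W..<i * W + W}. a (Suc j) * g (l (Suc j)))" for i
    proof -
      have "real W * a (Suc i * W) \<le> (\<Sum>j\<in>{i * W..<i * W + W}. g (l (Suc j))) * a (Suc i * W)"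
        using g_sum weight_seqD(1)[OF a, of "Suc i * W"] W by (intro mult_right_mono) (auto intro: less_imp_le)
      also have "\<dots> = (\<Sum>j\<in>{i * W..<i * W + W}. a (Suc i * W) * g (l (Suc j)))"
        unfolding sum_distrib_right by (intro sum.cong refl mult.commute)
      also have "\<dots> \<le> (\<Sum>j\<in>{i * W..<i * W + W}. a (Suc j) * g (l (Suc j)))"
      proof (intro sum_mono mult_right_mono)
        fix j assume "j \<in> {i * W..<i * W + W}"
        then show "a (Suc i * W) \<le> a (Suc j)"
          using W by (intro monotone_onD[OF mono]) auto
      qed (simp add: g_def)
      finally show ?thesis .
    qed
    have "real W * (\<Sum>\<^sub>\<infinity>j\<in>{1..}. a (j * W)) \<le> (\<Sum>\<^sub>\<infinity>j\<in>{1..}. a j * g (l j))"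
      by (rule sums_le[OF block sums1 sums2])
    then show ?thesis
      unfolding g_eq integral_atomic_measure(2)[OF a l cont] .
  qed
  then have "real W * (\<Sum>\<^sub>\<infinity>j\<in>{1..}. a (j * W)) \<le> (szego_e n (atomic_measure a l))\<^sup>2"
    unfolding szego_e_sq by (intro cINF_greatest) auto
  with szego_e_star_sq_ge[OF a l, of n] show ?thesis
    by (simp add: W_def)
qed

lemma progression_sum_ge:
  assumes a: "weight_seq a"
  shows "a (n + 1) \<le> (\<Sum>\<^sub>\<infinity>j\<in>{1..}. a (j * (n + 1)))"
proof -
  have "a summable_on (\<lambda>j. j * (n + 1)) ` {1..}"
    by (intro summable_on_subset_banach[OF weight_seqD(2)[OF a]]) auto
  then have summ: "(\<lambda>j. a (j * (n + 1))) summable_on {1..}"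
    by (subst (asm) summable_on_reindex)
      (auto simp: inj_on_def o_def simp del: mult_Suc_right add_Suc_right)
  have "a (n + 1) = infsum (\<lambda>j. a (j * (n + 1))) {1}"
    by simp
  also have "\<dots> \<le> infsum (\<lambda>j. a (j * (n + 1))) {1..}"
    using weight_seqD(1)[OF a] by (intro infsum_mono2 summ) (auto intro!: less_imp_le)
  finally show ?thesis .
qed

text \<open>\<open>M\<close> is the threshold for L = |log s_k|. Above it, c \<le> L^(1/\<gamma> -
  1), an increasing power because \<gamma> < 1, so the hypothesis yields k L^2 \<le> n. Up to it, 1
  = exp L * s_k \<le> exp M * s_k and the trivial bound e_n \<le> 1 is enough.\<close>

lemma szego_e_star_sq_le_tail_sum:
  fixes \<gamma> c :: real
  assumes \<gamma>: "0 < \<gamma>" "\<gamma> < 1" and c: "0 < c"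
  defines "M \<equiv> max 1 (c powr (1 / (1 / \<gamma> - 1)))"
  assumes a: "weight_seq a" and k: "k \<ge> 1"
    and hyp: "real k * \<bar>ln (tail_sum a k)\<bar> powr (1 + 1 / \<gamma>) \<le> c * real n"
  shows "(szego_e_star n a)\<^sup>2 \<le> (exp M + 50 * exp 2) * tail_sum a k"
proof -
  define s where "s = tail_sum a k"
  define L where "L = - ln s"
  have s: "0 < s" "s < 1"
    using tail_sum_bounds[OF a k] by (auto simp: s_def)
  then have s_eq: "s = exp (- L)" and L_eq: "\<bar>ln s\<bar> = L"
    by (auto simp: L_def)
  show ?thesis
  proof (cases "L \<le> M")
    case True
    have "(szego_e_star n a)\<^sup>2 \<le> 1"
      using szego_e_atomic_measure_le_1[OF a] a
      by (intro szego_e_star_sq_le) (auto simp: power_le_one szego_e_nonneg)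
    also have "1 \<le> exp M * s"
      using True by (simp add: s_eq flip: exp_add)
    also have "\<dots> \<le> (exp M + 50 * exp 2) * s"
      using s by (intro mult_right_mono) auto
    finally show ?thesis
      by (simp add: s_def)
  next
    case False
    then have L: "L > 1" and "L > c powr (1 / (1 / \<gamma> - 1))"
      by (auto simp: M_def)
    have e: "1 / \<gamma> - 1 > 0"
      using \<gamma> by simp
    then have e1: "1 / (1 / \<gamma> - 1) * (1 / \<gamma> - 1) = 1"
      by (intro nonzero_eq_divide_eq[THEN iffD1, OF _ refl]) (rule less_imp_neq[symmetric])
    have "c = (c powr (1 / (1 / \<gamma> - 1))) powr (1 / \<gamma> - 1)"
      unfolding powr_powr e1 using c by simp
    also have "\<dots> \<le> L powr (1 / \<gamma> - 1)"
      using \<open>L > c powr _\<close> e by (intro powr_mono2) auto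
    finally have cL: "c \<le> L powr (1 / \<gamma> - 1)" .
    have "c * (real k * L\<^sup>2) \<le> L powr (1 / \<gamma> - 1) * (real k * L\<^sup>2)"
      using cL by (intro mult_right_mono) auto
    also have "\<dots> = real k * (L powr (1 / \<gamma> - 1) * L powr 2)"
      using L by (simp add: powr_numeral)
    also have "\<dots> = real k * L powr (1 + 1 / \<gamma>)"
      by (simp add: add.commute flip: powr_add)
    also have "\<dots> \<le> c * real n"
      using hyp by (simp add: L_eq flip: s_def)
    finally have n: "real k * L\<^sup>2 \<le> real n"
      using c by simp
    have "(szego_e n (atomic_measure a l))\<^sup>2 \<le> 50 * exp 2 * s" if l: "l \<in> {1..} \<rightarrow> sphere 0 1" for l
    proof -
      have "norm (l i) = 1" if "i \<in> {1..k}" for i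
        using funcset_mem[OF l, of i] that by simp
      then obtain Q :: "complex poly" where Q: "degree Q \<le> n" "poly Q 0 = 1"
          "\<And>z. norm z = 1 \<Longrightarrow> norm (poly Q z) \<le> 5 * exp 1"
          "\<And>i. i \<in> {1..k} \<Longrightarrow> norm (poly Q (l i)) \<le> 5 * exp 1 * exp (- L / 2)"
        using small_polynomial_at_points[OF _ k L n] by blast
      \<comment> \<open>As exp (- L) = s, both terms equal \<open>25 * exp 2 * s\<close>.\<close>
      have "(szego_e n (atomic_measure a l))\<^sup>2 \<le> (5 * exp 1 * exp (- L / 2))\<^sup>2 + (5 * exp 1)\<^sup>2 * s"
        unfolding s_def by (rule szego_e_sq_le[OF Q(1,2) a l Q(4,3)])
      also have "\<dots> = 50 * exp 2 * s"
        by (simp add: s_eq power_mult_distrib flip: exp_double)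
      finally show ?thesis .
    qed
    then have "(szego_e_star n a)\<^sup>2 \<le> 50 * exp 2 * s"
      using a by (rule szego_e_star_sq_le)
    also have "\<dots> \<le> (exp M + 50 * exp 2) * s"
      using s by (intro mult_right_mono) auto
    finally show ?thesis
      by (simp add: s_def)
  qed
qed

text \<open>Only the tail contributes, with squared bound exp (8 k^2 / n). The hypothesis says 8 k^2
  / n \<le> \<sigma> |log s_k|, so this factor is at most s_k^(-\<sigma>). The assumption k \<le> n
  lets k factors of positive degree fit into degree n.\<close>

lemma szego_e_star_sq_le_tail_sum_powr:
  fixes \<sigma> :: real
  assumes a: "weight_seq a" and k: "k \<ge> 1" "k \<le> n"
    and hyp: "(real k)\<^sup>2 * inverse \<bar>ln (tail_sum a k)\<bar> \<le> 1 / 8 * \<sigma> * real n"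
  shows "(szego_e_star n a)\<^sup>2 \<le> tail_sum a k powr (1 - \<sigma>)"
proof -
  define s where "s = tail_sum a k"
  define L where "L = - ln s"
  have s: "0 < s" "s < 1"
    using tail_sum_bounds[OF a k(1)] by (auto simp: s_def)
  then have L: "L > 0" and L_eq: "\<bar>ln s\<bar> = L"
    by (auto simp: L_def)
  have "(real k)\<^sup>2 \<le> 1 / 8 * \<sigma> * real n * L"
    using hyp L by (simp add: L_eq field_simps flip: s_def)
  then have E: "8 * (real k)\<^sup>2 / real n \<le> \<sigma> * L"
    using k by (simp add: field_simps)
  show ?thesis
  proof (rule szego_e_star_sq_le[OF _ a])
    fix l :: "nat \<Rightarrow> complex"
    assume l: "l \<in> {1..} \<rightarrow> sphere 0 1"
    have "norm (l i) = 1" if "i \<in> {1..k}" for i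
      using funcset_mem[OF l, of i] that by simp
    then obtain Q :: "complex poly" where Q: "degree Q \<le> n" "poly Q 0 = 1"
        "\<And>i. i \<in> {1..k} \<Longrightarrow> poly Q (l i) = 0"
        "\<And>z. norm z = 1 \<Longrightarrow> norm (poly Q z) \<le> exp (4 * (real k)\<^sup>2 / real n)"
      using polynomial_with_zeros_on_circle[OF _ k] by blast
    have "(szego_e n (atomic_measure a l))\<^sup>2 \<le> 0\<^sup>2 + (exp (4 * (real k)\<^sup>2 / real n))\<^sup>2 * s"
      unfolding s_def by (rule szego_e_sq_le[OF Q(1,2) a l _ Q(4)]) (simp add: Q(3))
    also have "\<dots> = exp (8 * (real k)\<^sup>2 / real n) * s"
      by (simp flip: exp_double)
    also have "\<dots> \<le> exp (\<sigma> * L) * s"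
      using E s by (intro mult_right_mono) auto
    also have "\<dots> = s powr (- \<sigma>) * s powr 1"
      using s by (simp add: powr_def[of s "- \<sigma>"] L_def)
    also have "\<dots> = s powr (1 - \<sigma>)"
      by (simp only: powr_add[symmetric]) simp
    finally show "(szego_e n (atomic_measure a l))\<^sup>2 \<le> tail_sum a k powr (1 - \<sigma>)"
      by (simp add: s_def)
  qed
qed

text \<open>The implied constant in the hypothesis of (ii) is the explicit \<open>c\<close>;
  \<open>C\<close> is chosen after \<open>\<gamma>\<close> and \<open>c\<close> but before
  \<open>a\<close>, \<open>n\<close> and \<open>k\<close>.\<close>

theorem theorem6:
  shows
    "(\<forall>(a :: nat \<Rightarrow> real) (n :: nat).
        weight_seq a \<longrightarrow> n \<ge> 1 \<longrightarrow> antimono_on {1..} a \<longrightarrow>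
          (szego_e_star n a)\<^sup>2 \<ge> real (n + 1) * (\<Sum>\<^sub>\<infinity>j\<in>{1..}. a (j * (n + 1))) \<and>
          (szego_e_star n a)\<^sup>2 \<ge> real (n + 1) * a (n + 1))
   \<and> (\<forall>\<gamma> c :: real. 0 < \<gamma> \<longrightarrow> \<gamma> < 1 \<longrightarrow> 0 < c \<longrightarrow>
        (\<exists>C > 0. \<forall>(a :: nat \<Rightarrow> real) (n :: nat) (k :: nat).
          weight_seq a \<longrightarrow> n \<ge> 1 \<longrightarrow> k \<ge> 1 \<longrightarrow>
          real k * \<bar>ln (tail_sum a k)\<bar> powr (1 + 1 / \<gamma>) \<le> c * real n \<longrightarrow>
            (szego_e_star n a)\<^sup>2 \<le> C * tail_sum a k))
   \<and> (\<forall>(\<sigma> :: real) (a :: nat \<Rightarrow> real) (n :: nat) (k :: nat).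
        0 < \<sigma> \<longrightarrow> \<sigma> \<le> 1 / 2 \<longrightarrow> weight_seq a \<longrightarrow> n \<ge> 1 \<longrightarrow> k \<ge> 1 \<longrightarrow> k \<le> n \<longrightarrow>
        (real k)\<^sup>2 * inverse \<bar>ln (tail_sum a k)\<bar> \<le> 1 / 8 * \<sigma> * real n \<longrightarrow>
          (szego_e_star n a)\<^sup>2 \<le> tail_sum a k powr (1 - \<sigma>))"
proof (intro conjI allI impI)
  fix a :: "nat \<Rightarrow> real" and n :: nat
  assume a: "weight_seq a" and mono: "antimono_on {1..} a"
  show "real (n + 1) * (\<Sum>\<^sub>\<infinity>j\<in>{1..}. a (j * (n + 1))) \<le> (szego_e_star n a)\<^sup>2"
    by (rule szego_e_star_sq_ge_progression_sum[OF a mono])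
  moreover have "real (n + 1) * a (n + 1) \<le> real (n + 1) * (\<Sum>\<^sub>\<infinity>j\<in>{1..}. a (j * (n + 1)))"
    by (intro mult_left_mono progression_sum_ge[OF a]) simp
  ultimately show "real (n + 1) * a (n + 1) \<le> (szego_e_star n a)\<^sup>2"
    by (rule order_trans[rotated])
next
  fix \<gamma> c :: real
  assume "0 < \<gamma>" "\<gamma> < 1" "0 < c"
  note bound = szego_e_star_sq_le_tail_sum[OF this]
  show "\<exists>C > 0. \<forall>(a :: nat \<Rightarrow> real) (n :: nat) (k :: nat).
      weight_seq a \<longrightarrow> n \<ge> 1 \<longrightarrow> k \<ge> 1 \<longrightarrow>
      real k * \<bar>ln (tail_sum a k)\<bar> powr (1 + 1 / \<gamma>) \<le> c * real n \<longrightarrow>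
        (szego_e_star n a)\<^sup>2 \<le> C * tail_sum a k"
  proof (intro exI conjI allI impI)
    show "0 < exp (max 1 (c powr (1 / (1 / \<gamma> - 1)))) + 50 * exp (2::real)"
      by (intro add_pos_pos) auto
  qed (rule bound)
next
  fix \<sigma> :: real and a :: "nat \<Rightarrow> real" and n k :: nat
  assume "weight_seq a" "k \<ge> 1" "k \<le> n"
    and "(real k)\<^sup>2 * inverse \<bar>ln (tail_sum a k)\<bar> \<le> 1 / 8 * \<sigma> * real n"
  then show "(szego_e_star n a)\<^sup>2 \<le> tail_sum a k powr (1 - \<sigma>)"
    by (rule szego_e_star_sq_le_tail_sum_powr)
qed

end
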